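(* Let $n \geq 6$. Consider a position of $n$-Sim in which the coloured edges are exactly the edges of a drawn $K_5$ on some five of the vertices with one red edge removed (that is, left uncoloured), so that there are five green edges and four red edges, all other edges of the board are uncoloured, and it is PII's turn to move. Then this position is a PII win.
   Context: The game $n$-Sim: the board is the complete graph on $n$ vertices. Two players, PI and PII, alternately colour one previously uncoloured edge, PI moving first; PI colours edges green and PII colours edges red. The first player to complete a triangle all of whose edges are in his own colour loses (the game ends immediately). If all edges are coloured with no monochromatic triangle, the game is a draw (this cannot happen for $n\ge 6$). A position is a partial colouring of the edges by green and red containing no monochromatic triangle. The player to move is determined by the edge counts: PI moves if the numbers of green and red edges are equal, and PII moves if there is exactly one more green edge than red. A position is a "PII win" (respectively "PI win") if PII (respectively PI) has a winning strategy when play continues from that position. A "drawn $K_5$" on a set of five vertices is a colouring of all ten edges among them in which the five green edges form a 5-cycle and the five red edges form the complementary 5-cycle (this is the unique colouring of $K_5$ in two colours without a monochromatic triangle, up to isomorphism). *)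

theory Defs
  imports Main
begin

definition board :: "'a set \<Rightarrow> 'a set set" where
  "board V = {e. e \<subseteq> V \<and> card e = 2}"

definition has_triangle :: "'a set set \<Rightarrow> bool" where
  "has_triangle E \<longleftrightarrow>
     (\<exists>a b c. a \<noteq> b \<and> b \<noteq> c \<and> a \<noteq> c \<and> {a, b} \<in> E \<and> {b, c} \<in> E \<and> {a, c} \<in> E)"

datatype player = Player1 | Player2

text \<open>A state \<open>(G, R)\<close> consists of the set of green edges (coloured by the first player) and the
  set of red edges (coloured by the second player). States also include the final
  configurations, in which the last move may have completed a monochromatic triangle;
  the triangle-free ones with admissible edge counts are the positions.\<close>

type_synonym 'a state = "'a set set \<times> 'a set set"

definition is_position :: "'a set \<Rightarrow> 'a state \<Rightarrow> bool" where
  "is_position V s \<longleftrightarrow> (case s of (G, R) \<Rightarrow>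
     G \<subseteq> board V \<and> R \<subseteq> board V \<and> G \<inter> R = {} \<and>
     \<not> has_triangle G \<and> \<not> has_triangle R \<and>
     (card G = card R \<or> card G = card R + 1))"

definition to_move :: "'a state \<Rightarrow> player" where
  "to_move s = (case s of (G, R) \<Rightarrow> if card G = card R then Player1 else Player2)"

definition free_edges :: "'a set \<Rightarrow> 'a state \<Rightarrow> 'a set set" where
  "free_edges V s = (case s of (G, R) \<Rightarrow> board V - (G \<union> R))"

definition make_move :: "'a state \<Rightarrow> 'a set \<Rightarrow> 'a state" where
  "make_move s e = (case s of (G, R) \<Rightarrow>
     (case to_move s of
        Player1 \<Rightarrow> (insert e G, R)
      | Player2 \<Rightarrow> (G, insert e R)))"

fun has_lost :: "player \<Rightarrow> 'a state \<Rightarrow> bool" where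
  "has_lost Player1 (G, R) \<longleftrightarrow> has_triangle G"
| "has_lost Player2 (G, R) \<longleftrightarrow> has_triangle R"

fun opponent :: "player \<Rightarrow> player" where
  "opponent Player1 = Player2"
| "opponent Player2 = Player1"

definition game_over :: "'a set \<Rightarrow> 'a state \<Rightarrow> bool" where
  "game_over V s \<longleftrightarrow> has_lost Player1 s \<or> has_lost Player2 s \<or> free_edges V s = {}"

text \<open>The states occurring in plays from \<open>s0\<close> in which player \<open>P\<close> follows the strategy \<open>\<sigma>\<close>
  while the opponent colours arbitrary uncoloured edges.\<close>

inductive occurs_in_play :: "'a set \<Rightarrow> player \<Rightarrow> ('a state \<Rightarrow> 'a set) \<Rightarrow> 'a state \<Rightarrow> 'a state \<Rightarrow> bool"
  for V :: "'a set" and P :: player and \<sigma> :: "'a state \<Rightarrow> 'a set" and s0 :: "'a state" where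
  start: "occurs_in_play V P \<sigma> s0 s0"
| own: "occurs_in_play V P \<sigma> s0 s \<Longrightarrow> \<not> game_over V s \<Longrightarrow> to_move s = P
          \<Longrightarrow> occurs_in_play V P \<sigma> s0 (make_move s (\<sigma> s))"
| other: "occurs_in_play V P \<sigma> s0 s \<Longrightarrow> \<not> game_over V s \<Longrightarrow> to_move s = opponent P
          \<Longrightarrow> e \<in> free_edges V s \<Longrightarrow> occurs_in_play V P \<sigma> s0 (make_move s e)"

text \<open>A winning strategy always prescribes a legal move, and every play following it ends
  with the opponent having completed a triangle in the opponent's colour; a full board
  without monochromatic triangle is a draw and hence not a win. On a finite board every
  play terminates because each legal move uses up an uncoloured edge.\<close>

definition winning_strategy :: "'a set \<Rightarrow> player \<Rightarrow> ('a state \<Rightarrow> 'a set) \<Rightarrow> 'a state \<Rightarrow> bool" where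
  "winning_strategy V P \<sigma> s0 \<longleftrightarrow>
     (\<forall>s. occurs_in_play V P \<sigma> s0 s \<longrightarrow>
        (\<not> game_over V s \<and> to_move s = P \<longrightarrow> \<sigma> s \<in> free_edges V s) \<and>
        (game_over V s \<longrightarrow> has_lost (opponent P) s \<and> \<not> has_lost P s))"

definition is_win :: "'a set \<Rightarrow> player \<Rightarrow> 'a state \<Rightarrow> bool" where
  "is_win V P s \<longleftrightarrow> (\<exists>\<sigma>. winning_strategy V P \<sigma> s)"

definition five_cycle_on :: "'a set \<Rightarrow> 'a set set \<Rightarrow> bool" where
  "five_cycle_on W E \<longleftrightarrow>
     (\<exists>a b c d e. distinct [a, b, c, d, e] \<and> W = {a, b, c, d, e} \<and>
        E = {{a, b}, {b, c}, {c, d}, {d, e}, {e, a}})"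

definition drawn_K5 :: "'a set \<Rightarrow> 'a set set \<Rightarrow> 'a set set \<Rightarrow> bool" where
  "drawn_K5 W G R \<longleftrightarrow>
     card W = 5 \<and> G \<inter> R = {} \<and> G \<union> R = board W \<and> five_cycle_on W G \<and> five_cycle_on W R"

end

theory Submission
  imports Defs
begin

text \<open>Strategy stealing. Suppose the drawn \<open>K\<^sub>5\<close> with the first player to move is a win
  for the second player. Then the second player wins by colouring the missing edge. Otherwise
  there is no draw (Ramsey), so whoever moves first from a drawn \<open>K\<^sub>5\<close> wins, the drawn \<open>K\<^sub>5\<close>
  being isomorphic to its colour-swap. The second player then plays as if the missing edge were
  already red and wins as the first to move. The pretence is harmless: the first player cannot
  colour the missing edge without completing a green triangle.\<close>

section \<open>Winning as a least fixed point, and strategies extracted from it\<close>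

text \<open>The inductive form lets a win be transferred between games by rule induction, without
  handling strategies or plays. The rules \<open>own\<close> and \<open>other\<close> demand an
  unfinished game, so a finished state enters only through \<open>over\<close> and a draw never
  counts.\<close>

inductive wins :: "'a set \<Rightarrow> player \<Rightarrow> 'a state \<Rightarrow> bool" for V :: "'a set" and P :: player where
  over: "has_lost (opponent P) s \<Longrightarrow> \<not> has_lost P s \<Longrightarrow> wins V P s"
| own: "\<not> game_over V s \<Longrightarrow> to_move s = P \<Longrightarrow> e \<in> free_edges V s
    \<Longrightarrow> wins V P (make_move s e) \<Longrightarrow> wins V P s"
| other: "\<not> game_over V s \<Longrightarrow> to_move s = opponent P
    \<Longrightarrow> (\<And>e. e \<in> free_edges V s \<Longrightarrow> wins V P (make_move s e)) \<Longrightarrow> wins V P s"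

lemma neq_opponent: "P \<noteq> opponent P"
  by (cases P) auto

lemma opponent_opponent [simp]: "opponent (opponent P) = P"
  by (cases P) auto

lemma game_over_if_has_lost: "has_lost P s \<Longrightarrow> game_over V s"
  by (cases P) (auto simp: game_over_def)

text \<open>Picking any move that stays inside \<open>wins\<close> is a strategy: membership in
  \<open>wins\<close> is then an invariant of play, and a finished state in \<open>wins\<close> is
  lost for the opponent alone.\<close>

lemma is_win_if_wins:
  assumes "wins V P s0"
  shows "is_win V P s0"
proof -
  define \<sigma> where "\<sigma> s = (SOME e. e \<in> free_edges V s \<and> wins V P (make_move s e))" for s
  have \<sigma>: "\<sigma> s \<in> free_edges V s \<and> wins V P (make_move s (\<sigma> s))"
    if "wins V P s" "\<not> game_over V s" "to_move s = P" for s
  proof -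
    \<comment> \<open>Only the rule \<open>own\<close> fits: \<open>over\<close> would mean a
      finished game, and \<open>other\<close> needs the opponent to be on move.\<close>
    have "\<exists>e. e \<in> free_edges V s \<and> wins V P (make_move s e)"
      using that(1)
      by (cases rule: wins.cases) (use that game_over_if_has_lost neq_opponent in metis)+
    then show ?thesis unfolding \<sigma>_def by (rule someI_ex)
  qed
  have "wins V P s" if "occurs_in_play V P \<sigma> s0 s" for s
    using that
  proof induction
    case start
    show ?case by (fact assms)
  next
    case (own s)
    then show ?case using \<sigma> by blast
  next
    case (other s e)
    show ?case using other(5)
      by (cases rule: wins.cases) (use other game_over_if_has_lost neq_opponent in metis)+
  qed
  moreover have "has_lost (opponent P) s \<and> \<not> has_lost P s" if "wins V P s" "game_over V s" for s
    using that(1) by (cases rule: wins.cases) (use that(2) in auto)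
  ultimately have "winning_strategy V P \<sigma> s0"
    unfolding winning_strategy_def using \<sigma> by blast
  then show ?thesis unfolding is_win_def by blast
qed

section \<open>Triangles and edges under vertex maps\<close>

lemma has_triangleI:
  "a \<noteq> b \<Longrightarrow> b \<noteq> c \<Longrightarrow> a \<noteq> c \<Longrightarrow> {a, b} \<in> E \<Longrightarrow> {b, c} \<in> E \<Longrightarrow> {a, c} \<in> E \<Longrightarrow> has_triangle E"
  unfolding has_triangle_def by blast

lemma has_triangle_mono: "has_triangle E \<Longrightarrow> E \<subseteq> F \<Longrightarrow> has_triangle F"
  unfolding has_triangle_def by blast

lemma has_triangle_image_iff:
  assumes "inj f"
  shows "has_triangle ((`) f ` E) \<longleftrightarrow> has_triangle E"
proof
  assume "has_triangle E"
  then obtain a b c where "a \<noteq> b" "b \<noteq> c" "a \<noteq> c" "{a, b} \<in> E" "{b, c} \<in> E" "{a, c} \<in> E"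
    unfolding has_triangle_def by blast
  then have "f a \<noteq> f b" "f b \<noteq> f c" "f a \<noteq> f c"
    "f ` {a, b} \<in> (`) f ` E" "f ` {b, c} \<in> (`) f ` E" "f ` {a, c} \<in> (`) f ` E"
    using injD[OF assms] by blast+
  then show "has_triangle ((`) f ` E)" by (intro has_triangleI[of "f a" "f b" "f c"]) simp_all
next
  assume "has_triangle ((`) f ` E)"
  then obtain x y z where d: "x \<noteq> y" "y \<noteq> z" "x \<noteq> z" and
    e: "{x, y} \<in> (`) f ` E" "{y, z} \<in> (`) f ` E" "{x, z} \<in> (`) f ` E"
    unfolding has_triangle_def by blast
  then have "x \<in> range f" "y \<in> range f" "z \<in> range f" by blast+
  then obtain a b c where abc: "x = f a" "y = f b" "z = f c" by blast
  have "{u, v} \<in> E" if "{f u, f v} \<in> (`) f ` E" for u v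
  proof -
    have "f ` {u, v} \<in> (`) f ` E" using that by simp
    then show ?thesis using inj_image_eq_iff[OF assms] by (metis imageE)
  qed
  with d e show "has_triangle E" unfolding abc
    by (intro has_triangleI[of a b c]) auto
qed

lemma finite_board: "finite V \<Longrightarrow> finite (board V)"
  unfolding board_def by simp

lemma board_mono: "W \<subseteq> V \<Longrightarrow> board W \<subseteq> board V"
  unfolding board_def by auto

lemma doubleton_in_board_iff: "{x, y} \<in> board V \<longleftrightarrow> x \<in> V \<and> y \<in> V \<and> x \<noteq> y"
  unfolding board_def by (auto simp: card_insert_if)

lemma image_in_board_iff:
  assumes "inj f" "f ` V = V"
  shows "f ` e \<in> board V \<longleftrightarrow> e \<in> board V"
  unfolding board_def using assms inj_image_subset_iff[OF assms(1), of e V]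
  by (simp add: card_image inj_on_subset)

section \<open>Ramsey bound and determinacy\<close>

text \<open>Take three \<open>E\<close>-edges at \<open>v\<close>. An \<open>E\<close>-edge between
  two of their far ends closes a triangle through \<open>v\<close>; otherwise the far ends span a
  triangle in \<open>F\<close>.\<close>

lemma star_has_triangle:
  assumes "card A \<ge> 3" "A \<subseteq> V" "v \<in> V" "v \<notin> A" "\<And>x. x \<in> A \<Longrightarrow> {v, x} \<in> E"
    and "E \<union> F = board V"
  shows "has_triangle E \<or> has_triangle F"
proof -
  obtain T where "T \<subseteq> A" "card T = 3" using obtain_subset_with_card_n[OF assms(1)] by metis
  then obtain x y z where d: "{x, y, z} \<subseteq> A" "x \<noteq> y" "y \<noteq> z" "x \<noteq> z"
    by (auto simp: card_3_iff)
  show ?thesis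
  proof (cases "{x, y} \<in> E \<or> {y, z} \<in> E \<or> {x, z} \<in> E")
    case True
    then obtain p q where "{p, q} \<in> E" "p \<in> A" "q \<in> A" "p \<noteq> q" using d by auto
    then have "has_triangle E" using assms(4,5) by (intro has_triangleI[of v p q]) auto
    then show ?thesis ..
  next
    case False
    have "{x, y} \<in> board V" "{y, z} \<in> board V" "{x, z} \<in> board V"
      using d assms(2) by (auto simp: doubleton_in_board_iff)
    with False have "{x, y} \<in> F" "{y, z} \<in> F" "{x, z} \<in> F"
      unfolding assms(6)[symmetric] by auto
    then have "has_triangle F" using d by (intro has_triangleI[of x y z]) auto
    then show ?thesis ..
  qed
qed

text \<open>The bound R(3,3) \<le> 6: of the at least five edges at a vertex, three share a
  colour.\<close>

lemma no_draw:
  assumes "finite V" "card V \<ge> 6" "G \<union> R = board V"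
  shows "has_triangle G \<or> has_triangle R"
proof -
  obtain v where v: "v \<in> V" using assms(2) by fastforce
  define A where "A = {x \<in> V - {v}. {v, x} \<in> G}"
  define B where "B = {x \<in> V - {v}. {v, x} \<in> R}"
  have "{v, x} \<in> G \<or> {v, x} \<in> R" if "x \<in> V - {v}" for x
    using that v assms(3) doubleton_in_board_iff[of v x V] by auto
  then have "V - {v} = A \<union> B" unfolding A_def B_def by blast
  moreover have "card (V - {v}) \<ge> 5" using assms v by simp
  ultimately have "5 \<le> card A + card B" using card_Un_le[of A B] by simp
  then consider "card A \<ge> 3" | "card B \<ge> 3" by linarith
  then show ?thesis
  proof cases
    case 1
    then show ?thesis using v assms(3)
      by (intro star_has_triangle[of A V v]) (auto simp: A_def)
  next
    case 2
    then have "has_triangle R \<or> has_triangle G" using v assms(3)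
      by (intro star_has_triangle[of B V v]) (auto simp: B_def)
    then show ?thesis by blast
  qed
qed

lemma free_edges_make_move: "free_edges V (make_move s e) = free_edges V s - {e}"
  by (cases s; cases "to_move s") (auto simp: free_edges_def make_move_def)

text \<open>Backward induction on the number of uncoloured edges, with \<open>no_draw\<close> ruling
  out a full triangle-free board. States with triangles in both colours are excluded because
  \<open>wins\<close> awards them to nobody.\<close>

lemma determined:
  assumes "finite V" "card V \<ge> 6"
    and "fst s \<union> snd s \<subseteq> board V" "\<not> (has_triangle (fst s) \<and> has_triangle (snd s))"
  shows "wins V Player1 s \<or> wins V Player2 s"
  using assms(3,4)
proof (induction "card (free_edges V s)" arbitrary: s rule: less_induct)
  case less
  obtain G R where s: "s = (G, R)" by (cases s)
  consider "has_triangle G" | "has_triangle R" | "\<not> has_triangle G" "\<not> has_triangle R"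
    by blast
  then show ?case
  proof cases
    case 1
    then have "wins V Player2 s" using less.prems s by (intro wins.over) auto
    then show ?thesis ..
  next
    case 2
    then have "wins V Player1 s" using less.prems s by (intro wins.over) auto
    then show ?thesis ..
  next
    case 3
    then have "free_edges V s \<noteq> {}"
      using no_draw[OF assms(1,2), of G R] less.prems s by (auto simp: free_edges_def)
    with 3 have n: "\<not> game_over V s" by (simp add: game_over_def s)
    have IH: "wins V Player1 (make_move s e) \<or> wins V Player2 (make_move s e)"
      if e: "e \<in> free_edges V s" for e
    proof (rule less.hyps)
      have "finite (free_edges V s)"
        using finite_board[OF assms(1)] by (simp add: free_edges_def s)
      then show "card (free_edges V (make_move s e)) < card (free_edges V s)"
        using e unfolding free_edges_make_move by (rule card_Diff1_less)
      show "fst (make_move s e) \<union> snd (make_move s e) \<subseteq> board V"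
        using less.prems(1) e
        by (cases "to_move s") (auto simp: make_move_def free_edges_def s)
      \<comment> \<open>Neither colour has a triangle before the move, and the move enlarges only
        one of them.\<close>
      show "\<not> (has_triangle (fst (make_move s e)) \<and> has_triangle (snd (make_move s e)))"
        using 3 by (cases "to_move s") (auto simp: make_move_def s)
    qed
    define P where "P = to_move s"
    have IHP: "wins V P (make_move s e) \<or> wins V (opponent P) (make_move s e)"
      if "e \<in> free_edges V s" for e
      using IH[OF that] by (cases P) auto
    have "wins V P s \<or> wins V (opponent P) s"
    proof (cases "\<exists>e \<in> free_edges V s. wins V P (make_move s e)")
      case True
      then show ?thesis using wins.own[OF n P_def[symmetric]] by blast
    next
      case False
      then have "wins V (opponent P) s"
        using wins.other[OF n, of "opponent P"] P_def IHP by auto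
      then show ?thesis ..
    qed
    then show ?thesis by (cases P) auto
  qed
qed

section \<open>Strategy stealing: the real game and the imagined one\<close>

text \<open>The imagined state belonging to a real state \<open>s\<close>: \<open>r\<close> is
  pretended to be red, the vertices are moved by \<open>f\<close>, and the colours are exchanged.
  The real second player is thus the imagined first player.\<close>

definition steal :: "('a \<Rightarrow> 'a) \<Rightarrow> 'a set \<Rightarrow> 'a state \<Rightarrow> 'a state" where
  "steal f r s = ((`) f ` insert r (snd s), (`) f ` fst s)"

lemma free_edges_steal:
  assumes "inj f" "f ` V = V"
  shows "f ` e \<in> free_edges V (steal f r s) \<longleftrightarrow> e \<in> free_edges V s - {r}"
  using inj_image_eq_iff[OF assms(1)] image_in_board_iff[OF assms]
  by (cases s) (auto simp: free_edges_def steal_def inj_image_mem_iff inj_on_def simp del: image_insert)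

lemma card_image_image: "inj f \<Longrightarrow> card ((`) f ` E) = card E"
  by (intro card_image) (simp add: inj_on_def inj_image_eq_iff)

text \<open>The pretended edge keeps the turns in step: equal real counts become one extra imagined
  green edge, and one extra real green edge becomes equal imagined counts.\<close>

lemma to_move_steal:
  assumes "inj f" "finite (snd s)" "r \<notin> snd s"
    and "card (fst s) = card (snd s) \<or> card (fst s) = card (snd s) + 1"
  shows "to_move (steal f r s) = opponent (to_move s)"
  using assms by (cases s) (auto simp: to_move_def steal_def card_image_image simp del: image_insert)

lemma make_move_steal:
  assumes "to_move (steal f r s) = opponent (to_move s)"
  shows "make_move (steal f r s) (f ` e) = steal f r (make_move s e)"
  using assms
  by (cases s; cases "to_move s") (auto simp: make_move_def steal_def insert_commute)

text \<open>The two players differ: the imagined red player loses exactly when the real green one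
  does, but the imagined green player may also lose through \<open>r\<close>. Safety in the imagined
  game therefore implies real safety for the second player.\<close>

lemma has_lost_steal:
  assumes "inj f"
  shows "has_lost Player1 (steal f r s) \<longleftrightarrow> has_triangle (insert r (snd s))"
    and "has_lost Player2 (steal f r s) \<longleftrightarrow> has_lost Player1 s"
  using has_triangle_image_iff[OF assms]
  by (cases s; simp add: steal_def del: image_insert)+

text \<open>Rule induction on the imagined win. The set \<open>C\<close> is a green core with which
  \<open>r\<close> closes a triangle; the invariant is that \<open>C\<close> stays green and
  \<open>r\<close> stays uncoloured. Only the real first player could break it, and colouring
  \<open>r\<close> loses at once.\<close>

lemma wins_Player2_if_steal:
  assumes "finite V" "bij f" "f ` V = V"
    and "r \<in> board V" "has_triangle (insert r C)"
    and "wins V Player1 (steal f r s)"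
    and "C \<subseteq> fst s" "fst s \<union> snd s \<subseteq> board V" "r \<notin> fst s \<union> snd s"
    and "card (fst s) = card (snd s) \<or> card (fst s) = card (snd s) + 1"
  shows "wins V Player2 s"
proof -
  have f: "inj f" "surj f" using assms(2) by (auto simp: bij_def)
  have turn: "to_move (steal f r s) = opponent (to_move s)"
    if "fst s \<union> snd s \<subseteq> board V" "r \<notin> fst s \<union> snd s"
      "card (fst s) = card (snd s) \<or> card (fst s) = card (snd s) + 1" for s
    using that f(1) finite_subset[OF _ finite_board[OF assms(1)]]
    by (intro to_move_steal) auto
  \<comment> \<open>The edge \<open>r\<close> itself is still free in the real game, and a real
    triangle in either colour would show up in the imagined game.\<close>
  have not_over: "\<not> game_over V s"
    if "\<not> game_over V (steal f r s)" "r \<notin> fst s \<union> snd s" for s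
  proof -
    have "r \<in> free_edges V s" using that assms(4) by (cases s) (simp add: free_edges_def)
    moreover have "\<not> has_lost Player2 s"
      using that(1) has_lost_steal(1)[OF f(1), of r s] has_triangle_mono[OF _ subset_insertI]
      by (cases s) (auto simp: game_over_def)
    ultimately show ?thesis using that(1) has_lost_steal(2)[OF f(1), of r s]
      by (auto simp: game_over_def)
  qed
  have step: "C \<subseteq> fst (make_move s e)"
    "fst (make_move s e) \<union> snd (make_move s e) \<subseteq> board V"
    "r \<notin> fst (make_move s e) \<union> snd (make_move s e)"
    "card (fst (make_move s e)) = card (snd (make_move s e))
      \<or> card (fst (make_move s e)) = card (snd (make_move s e)) + 1"
    if "C \<subseteq> fst s" "fst s \<union> snd s \<subseteq> board V" "r \<notin> fst s \<union> snd s"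
      "card (fst s) = card (snd s) \<or> card (fst s) = card (snd s) + 1"
      "e \<in> free_edges V s" "e \<noteq> r" for s e
  proof -
    obtain G R where s: "s = (G, R)" by (cases s)
    have fin: "finite G" "finite R"
      using that(2) finite_subset[OF _ finite_board[OF assms(1)]] by (auto simp: s)
    have "e \<in> board V" "e \<notin> G" "e \<notin> R" using that(5) by (auto simp: s free_edges_def)
    then show "C \<subseteq> fst (make_move s e)"
      "fst (make_move s e) \<union> snd (make_move s e) \<subseteq> board V"
      "r \<notin> fst (make_move s e) \<union> snd (make_move s e)"
      "card (fst (make_move s e)) = card (snd (make_move s e))
        \<or> card (fst (make_move s e)) = card (snd (make_move s e)) + 1"
      using that fin by (auto simp: s make_move_def to_move_def)
  qed
  show ?thesis
    using assms(6-)
  proof (induction "steal f r s" arbitrary: s)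
    case over
    then show ?case
      using has_lost_steal[OF f(1), of r s] has_triangle_mono[OF _ subset_insertI, of "snd s" r]
      by (cases s) (auto intro!: wins.over)
  next
    case (own e)
    \<comment> \<open>The winning imagined move is pulled back to the real board. It cannot be
      \<open>r\<close>, whose image is already coloured there.\<close>
    define e' where "e' = f -` e"
    have e: "e = f ` e'" using f(2) by (simp add: e'_def surj_image_vimage_eq)
    have e': "e' \<in> free_edges V s" "e' \<noteq> r"
      using own.hyps(3) free_edges_steal[OF f(1) assms(3)] by (auto simp: e)
    have t: "to_move (steal f r s) = opponent (to_move s)" using turn own.prems by blast
    have "wins V Player2 (make_move s e')"
      using own.hyps(5)[of "make_move s e'"] step[OF own.prems e'] make_move_steal[OF t]
      by (simp add: e)
    moreover have "to_move s = Player2" using t own.hyps(2) by (cases "to_move s") auto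
    ultimately show ?case using wins.own[OF not_over[OF own.hyps(1) own.prems(3)] _ e'(1)] by blast
  next
    case other
    have t: "to_move (steal f r s) = opponent (to_move s)" using turn other.prems by blast
    then have P1: "to_move s = Player1" using other.hyps(2) by (cases "to_move s") auto
    have over: "\<not> game_over V s" using not_over other.hyps(1) other.prems(3) by blast
    have "wins V Player2 (make_move s e)" if e: "e \<in> free_edges V s" for e
    proof (cases "e = r")
      case True
      have "has_triangle (insert r (fst s))"
        using assms(5) by (rule has_triangle_mono) (use other.prems(1) in blast)
      moreover have "\<not> has_lost Player2 s" using over by (simp add: game_over_def)
      ultimately show ?thesis using P1 True
        by (cases s) (auto simp: make_move_def intro!: wins.over)
    next
      case False
      then have "f ` e \<in> free_edges V (steal f r s)"
        using e free_edges_steal[OF f(1) assms(3)] by blast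
      then show ?thesis
        using other.hyps(4)[OF _ make_move_steal[OF t]] step[OF other.prems e False] by blast
    qed
    with over show ?case using P1 by (intro wins.other[of V s Player2]) simp_all
  qed
qed

section \<open>The drawn \<open>K5\<close> and its symmetry\<close>

text \<open>The diagonals of a pentagon form the pentagram, listed here as the cycle
  \<open>a\<close>, \<open>c\<close>, \<open>e\<close>, \<open>b\<close>, \<open>d\<close>.\<close>

lemma pentagon_complement:
  assumes "distinct [a, b, c, d, e]"
  shows "board {a, b, c, d, e} - {{a, b}, {b, c}, {c, d}, {d, e}, {e, a}}
    = {{a, c}, {c, e}, {e, b}, {b, d}, {d, a}}" (is "?L = ?R")
proof
  show "?L \<subseteq> ?R"
  proof
    fix x assume x: "x \<in> ?L"
    then have "x \<in> board {a, b, c, d, e}" by blast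
    then obtain u v where x_eq: "x = {u, v}" unfolding board_def card_2_iff by blast
    from x have "u \<in> {a, b, c, d, e} \<and> v \<in> {a, b, c, d, e} \<and> u \<noteq> v
      \<and> {u, v} \<notin> {{a, b}, {b, c}, {c, d}, {d, e}, {e, a}}"
      unfolding x_eq Diff_iff doubleton_in_board_iff conj_assoc .
    then show "x \<in> ?R" unfolding x_eq
      by (elim conjE insertE emptyE) (simp_all add: doubleton_eq_iff)
  qed
  show "?R \<subseteq> ?L" using assms by (simp add: doubleton_in_board_iff doubleton_eq_iff) blast
qed

lemma drawn_K5E:
  assumes "drawn_K5 W G R"
  obtains a b c d e where "distinct [a, b, c, d, e]" "W = {a, b, c, d, e}"
    "G = {{a, b}, {b, c}, {c, d}, {d, e}, {e, a}}" "R = {{a, c}, {c, e}, {e, b}, {b, d}, {d, a}}"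
proof -
  from assms have "G \<inter> R = {}" "G \<union> R = board W" and cycle: "five_cycle_on W G"
    unfolding drawn_K5_def by simp_all
  then have R: "R = board W - G" by blast
  from cycle obtain a b c d e where d: "distinct [a, b, c, d, e]" and W: "W = {a, b, c, d, e}"
    and G: "G = {{a, b}, {b, c}, {c, d}, {d, e}, {e, a}}"
    unfolding five_cycle_on_def by (elim exE conjE) (rule that)
  show thesis using d W G R[unfolded W G pentagon_complement[OF d]] by (rule that)
qed

lemma drawn_K5_colour_swap:
  assumes "drawn_K5 W G R"
  obtains f where "bij f" "f ` W = W" "\<And>x. x \<notin> W \<Longrightarrow> f x = x" "(`) f ` G = R" "(`) f ` R = G"
proof -
  from assms obtain a b c d e where d: "distinct [a, b, c, d, e]" and W: "W = {a, b, c, d, e}"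
    and G: "G = {{a, b}, {b, c}, {c, d}, {d, e}, {e, a}}"
    and R: "R = {{a, c}, {c, e}, {e, b}, {b, d}, {d, a}}"
    by (rule drawn_K5E)
  \<comment> \<open>Numbering \<open>a\<close> to \<open>e\<close> as 0 to 4, \<open>f\<close> is
    doubling modulo 5 and \<open>g\<close> is halving. Doubling turns differences \<plusminus>1 into
    \<plusminus>2 and \<plusminus>2 into \<plusminus>1, so it exchanges sides and diagonals.\<close>
  define f where "f = id(b := c, c := e, e := d, d := b)"
  define g where "g = id(c := b, e := c, d := e, b := d)"
  have "g (f x) = x" "f (g x) = x" for x using d by (auto simp: f_def g_def)
  then have "bij f" by (metis bijI')
  moreover have "f a = a" "f b = c" "f c = e" "f e = d" "f d = b" using d by (auto simp: f_def)
  then have "f ` W = W" "(`) f ` G = R" "(`) f ` R = G"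
    unfolding W G R by (simp_all add: insert_commute)
  moreover have "f x = x" if "x \<notin> W" for x using that by (simp add: W f_def)
  ultimately show thesis using that by simp
qed

text \<open>Each diagonal cuts off one pentagon vertex, and the two sides meeting there are
  green.\<close>

lemma drawn_K5_green_triangle:
  assumes "drawn_K5 W G R" "r \<in> R"
  shows "has_triangle (insert r G)"
proof -
  from assms(1) obtain a b c d e where d: "distinct [a, b, c, d, e]"
    and G: "G = {{a, b}, {b, c}, {c, d}, {d, e}, {e, a}}"
    and R: "R = {{a, c}, {c, e}, {e, b}, {b, d}, {d, a}}"
    by (rule drawn_K5E)
  from assms(2) have "r = {a, c} \<or> r = {c, e} \<or> r = {e, b} \<or> r = {b, d} \<or> r = {d, a}"
    unfolding R by simp
  then consider "r = {a, c}" | "r = {c, e}" | "r = {e, b}" | "r = {b, d}" | "r = {d, a}" by (elim disjE)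
  then show ?thesis
  proof cases
    case 1
    then show ?thesis using d by (intro has_triangleI[of a b c]) (auto simp: G insert_commute)
  next
    case 2
    then show ?thesis using d by (intro has_triangleI[of c d e]) (auto simp: G insert_commute)
  next
    case 3
    then show ?thesis using d by (intro has_triangleI[of e a b]) (auto simp: G insert_commute)
  next
    case 4
    then show ?thesis using d by (intro has_triangleI[of b c d]) (auto simp: G insert_commute)
  next
    case 5
    then show ?thesis using d by (intro has_triangleI[of d e a]) (auto simp: G insert_commute)
  qed
qed

theorem theorem2:
  fixes V W :: "'a set" and n :: nat and G R :: "'a set set" and r :: "'a set" and p :: "'a state"
  assumes "finite V" and "card V = n" and "n \<ge> 6"
    and "is_position V p"
    and "W \<subseteq> V" and "drawn_K5 W G R" and "r \<in> R" and "p = (G, R - {r})"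
    and "to_move p = Player2"
  shows "is_win V Player2 p"
proof -
  have GR: "G \<union> R = board W" "G \<inter> R = {}" using assms(6) by (auto simp: drawn_K5_def)
  then have sub: "G \<union> R \<subseteq> board V" using board_mono[OF assms(5)] by simp
  then have r: "r \<in> board V" "r \<notin> G" using assms(7) GR(2) by auto
  have tri: "\<not> has_triangle G" "\<not> has_triangle (R - {r})"
    using assms(4,8) by (auto simp: is_position_def)
  \<comment> \<open>Determinacy is applied to the completed drawn \<open>K5\<close>, not to
    \<open>p\<close>.\<close>
  have "wins V Player1 (G, R) \<or> wins V Player2 (G, R)"
    using assms(1-3) sub tri(1) by (intro determined) auto
  then have "wins V Player2 p"
  proof
    assume w: "wins V Player2 (G, R)"
    have "r \<in> free_edges V p" using r assms(8) by (simp add: free_edges_def)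
    moreover from this have "\<not> game_over V p"
      using tri assms(8) by (auto simp: game_over_def)
    moreover have "make_move p r = (G, R)"
      using assms(7,8,9) by (auto simp: make_move_def)
    ultimately show ?thesis using w assms(9) wins.own[of V p Player2 r] by simp
  next
    assume w: "wins V Player1 (G, R)"
    obtain f where f: "bij f" "f ` W = W" "\<And>x. x \<notin> W \<Longrightarrow> f x = x"
      "(`) f ` G = R" "(`) f ` R = G"
      using drawn_K5_colour_swap[OF assms(6)] by blast
    have "f ` (V - W) = V - W" using f(3) by force
    then have fV: "f ` V = V" using f(2) assms(5) by (metis Un_Diff_cancel2 image_Un sup.absorb1)
    have "insert r (R - {r}) = R" using assms(7) by blast
    \<comment> \<open>As \<open>f\<close> exchanges the two cycles and \<open>steal\<close>
      exchanges the colours, the imagined start is the very state \<open>(G, R)\<close> that the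
      first player wins.\<close>
    then have "steal f r p = (G, R)" using f(4,5) assms(8) by (simp add: steal_def del: image_insert)
    then show ?thesis
      using w assms(1,4,8) f(1) fV r drawn_K5_green_triangle[OF assms(6,7)]
      \<comment> \<open>The green core \<open>C\<close> is the whole pentagon
        \<open>G\<close>.\<close>
      by (intro wins_Player2_if_steal[of V f r G]) (auto simp: is_position_def)
  qed
  then show ?thesis by (rule is_win_if_wins)
qed

end
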